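(* For simple value maximizers in a single parameter domain, a mechanism is truthful (DSIC-AE) if and only if it is monotone and the price is the minimum value required to get the same allocation, that is, if and only if, for each bidder $i$: (monotonicity) for any $v_{-i}$, $x_i(z,v_{-i})>x_i(v)$ if and only if $z>v_i$, almost everywhere over $v_i$; (pricing) $p_i(v)=\inf\{z : x_i(z,v_{-i})=x_i(v)\}$.
   Context: Setting. There are $n$ bidders (advertisers) and a set $\mathcal O$ of outcomes. In outcome $o\in\mathcal O$, the likelihood that the user clicks on bidder $i$'s ad is $x_i(o)$ ($i$'s allocation); when the user clicks, bidder $i$ pays a price $p_i$. Each bidder has a single private parameter, a value per click $v_i$, and a complete and transitive preference $\preceq_i$ over outcome-price pairs $(o,p_i)$. Mechanism. A mechanism asks bidders to report their values and specifies, for reports $\mathbf b$, an outcome $f(\mathbf b)$ and payments $p_i(\mathbf b)$; this induces the allocation $x_i(\mathbf b)=x_i(f(\mathbf b))$. Here $v=(v_i,v_{-i})$ denotes a profile of values, $v_{-i}$ the values of the bidders other than $i$, and $x_i(z,v_{-i})$ the allocation of bidder $i$ when $i$ reports $z$ and the others report $v_{-i}$. Simple value maximizer. A bidder with value $v_i$ is a simple value maximizer if it is value-maximizing subject to the constraint $p_i\le v_i$, meaning: if $v_ix_i(o)>v_ix_i(o')$ and $(o,p_i)$ satisfies the constraint, then $(o,p_i)\succ_i(o',p_i')$; if $x_i(o)=x_i(o')$, $p_i<p_i'$ and $(o,p_i)$ satisfies the constraint, then $(o,p_i)\succ_i(o',p_i')$; and if $(o',p_i')$ violates the constraint, then $(o,p_i)\succeq_i(o',p_i')$.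 DSIC-AE (dominant strategy incentive compatible almost everywhere). For any $i$ and bids $b_{-i}$, $(f(b_{-i},v_i),p_i(b_{-i},v_i))\succeq_i(f(b_{-i},b_i),p_i(b_{-i},b_i))$ for all values $v_i$ and deviations $b_i$, except a set of $v_i$ with measure zero.
   Formalization: Assumes values ≥ 0, 0 ≤ p_i(b) ≤ b_i, and indifference between outcomes of equal own allocation and price. Monotonicity is weak (plateaus allowed) and a.e.; pricing holds for a.e. v_i, plus p_i(v) ≥ inf{z : x_i(z,v_{-i}) ≥ x_i(v)} at every report. *)

theory Defs
  imports "HOL-Analysis.Analysis"
begin

text \<open>
  A preference is a relation \<open>R\<close> on outcome-price pairs; \<open>R a b\<close> reads
  ``\<open>a\<close> is weakly preferred to \<open>b\<close>''.
\<close>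

definition rational_preference :: "('a \<Rightarrow> 'a \<Rightarrow> bool) \<Rightarrow> bool" where
  "rational_preference R \<longleftrightarrow> (\<forall>a b. R a b \<or> R b a) \<and> transp R"

definition strictly_prefers :: "('a \<Rightarrow> 'a \<Rightarrow> bool) \<Rightarrow> 'a \<Rightarrow> 'a \<Rightarrow> bool" where
  "strictly_prefers R a b \<longleftrightarrow> R a b \<and> \<not> R b a"

definition simple_value_maximizer ::
    "('o \<Rightarrow> real) \<Rightarrow> real \<Rightarrow> ('o \<times> real \<Rightarrow> 'o \<times> real \<Rightarrow> bool) \<Rightarrow> bool" where
  "simple_value_maximizer x v R \<longleftrightarrow>
     rational_preference R \<and>
     (\<forall>a a' q q'. v * x a > v * x a' \<and> q \<le> v \<longrightarrow> strictly_prefers R (a, q) (a', q')) \<and>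
     (\<forall>a a' q q'. x a = x a' \<and> q < q' \<and> q \<le> v \<longrightarrow> strictly_prefers R (a, q) (a', q')) \<and>
     (\<forall>a a' q q'. \<not> q' \<le> v \<longrightarrow> R (a, q) (a', q'))"

text \<open>
  In a single parameter domain an outcome matters to a bidder only through that bidder's own
  allocation. The three clauses above leave open how two outcomes with equal allocation and equal
  price are ranked; this is what settles it (applied in both directions, it gives indifference).
\<close>

definition depends_only_on_allocation ::
    "('o \<Rightarrow> real) \<Rightarrow> ('o \<times> real \<Rightarrow> 'o \<times> real \<Rightarrow> bool) \<Rightarrow> bool" where
  "depends_only_on_allocation x R \<longleftrightarrow> (\<forall>a a' q. x a = x a' \<longrightarrow> R (a, q) (a', q))"

text \<open>
  Values and reports range over the nonnegative reals. A profile \<open>b\<close> also encodes the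
  reports of the bidders other than \<open>i\<close>: below only \<open>b(i := z)\<close> is ever used, so the
  entry \<open>b i\<close> is irrelevant.
\<close>

definition profiles :: "('n \<Rightarrow> real) set" where
  "profiles = {b. \<forall>j. 0 \<le> b j}"

definition dsic_ae ::
    "('n \<Rightarrow> real \<Rightarrow> 'o \<times> real \<Rightarrow> 'o \<times> real \<Rightarrow> bool) \<Rightarrow>
     (('n \<Rightarrow> real) \<Rightarrow> 'o) \<Rightarrow> ('n \<Rightarrow> ('n \<Rightarrow> real) \<Rightarrow> real) \<Rightarrow> bool" where
  "dsic_ae pref f p \<longleftrightarrow>
     (\<forall>i. \<forall>b\<in>profiles. AE v in lborel. 0 \<le> v \<longrightarrow>
        (\<forall>z\<ge>0. pref i v (f (b(i := v)), p i (b(i := v))) (f (b(i := z)), p i (b(i := z)))))"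

text \<open>
  The allocation of bidder \<open>i\<close> as a function of the own report. The allocation may be constant
  on intervals, so a larger report need not be served strictly more; and a null set of reports may
  be served arbitrarily little without affecting incentives. Hence the implication from
  ``larger allocation'' to ``larger report'' is required of all reports \<open>z\<close>, the converse in its
  weak form and for almost all \<open>z\<close>.
\<close>

definition alloc_curve ::
    "('n \<Rightarrow> 'o \<Rightarrow> real) \<Rightarrow> (('n \<Rightarrow> real) \<Rightarrow> 'o) \<Rightarrow> 'n \<Rightarrow> ('n \<Rightarrow> real) \<Rightarrow> real \<Rightarrow> real" where
  "alloc_curve x f i b z = x i (f (b(i := z)))"

definition monotone_ae ::
    "('n \<Rightarrow> 'o \<Rightarrow> real) \<Rightarrow> (('n \<Rightarrow> real) \<Rightarrow> 'o) \<Rightarrow> 'n \<Rightarrow> bool" where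
  "monotone_ae x f i \<longleftrightarrow>
     (\<forall>b\<in>profiles. AE v in lborel. 0 \<le> v \<longrightarrow>
        (\<forall>z\<ge>0. alloc_curve x f i b z > alloc_curve x f i b v \<longrightarrow> z > v) \<and>
        (AE z in lborel. z > v \<longrightarrow> alloc_curve x f i b z \<ge> alloc_curve x f i b v))"

text \<open>
  Incentives for almost every value determine prices only at almost every report. At the remaining
  reports the price must still be too high to attract a positive-measure set of deviating values,
  which is the second conjunct. It is implied wherever the first equation holds.
\<close>

definition minimum_pricing ::
    "('n \<Rightarrow> 'o \<Rightarrow> real) \<Rightarrow> (('n \<Rightarrow> real) \<Rightarrow> 'o) \<Rightarrow> ('n \<Rightarrow> ('n \<Rightarrow> real) \<Rightarrow> real) \<Rightarrow> 'n \<Rightarrow> bool" where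
  "minimum_pricing x f p i \<longleftrightarrow>
     (\<forall>b\<in>profiles.
        (AE v in lborel. 0 \<le> v \<longrightarrow>
           p i (b(i := v)) = Inf {z. 0 \<le> z \<and> alloc_curve x f i b z = alloc_curve x f i b v}) \<and>
        (\<forall>v\<ge>0.
           p i (b(i := v)) \<ge> Inf {z. 0 \<le> z \<and> alloc_curve x f i b z \<ge> alloc_curve x f i b v}))"

end

theory Submission
  imports Defs
begin

text \<open>
  Fix a bidder and the other reports, and let \<open>g\<close> and \<open>r\<close> be the allocation and the price as
  functions of the own report. Since the truthful price never exceeds the value, truth-telling is
  optimal at \<open>v > 0\<close> iff every report priced at most \<open>v\<close> gets no more than \<open>g v\<close>, and no less than
  \<open>r v\<close> is charged for exactly \<open>g v\<close>.

  If this holds for almost all values, a price below the claimed infimum would attract some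
  truthful value lying strictly between the two. Conversely, monotonicity and the price bounds
  rule out every profitable deviation except at values \<open>v\<close> that are the unattained infimum of
  some upper level set of \<open>g\<close>. At such a value \<open>g\<close> jumps upwards, and the jumps at different
  values span disjoint open intervals, so there are only countably many of them.
\<close>

definition truthful_at :: "(real \<Rightarrow> real) \<Rightarrow> (real \<Rightarrow> real) \<Rightarrow> real \<Rightarrow> bool" where
  "truthful_at g r v \<longleftrightarrow>
     (\<forall>z\<ge>0. r z \<le> v \<longrightarrow> g z \<le> g v \<and> (g z = g v \<longrightarrow> r v \<le> r z))"

text \<open>Since \<open>0 < v\<close>, comparing values amounts to comparing allocations, and
  \<open>r v \<le> v\<close> makes the truthful pair affordable. The maximizer clauses then settle
  every deviation except one with equal allocation and equal price, where \<open>alloc\<close> gives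
  indifference.\<close>

lemma truthful_at_iff_prefers:
  assumes svm: "simple_value_maximizer y v R" and alloc: "depends_only_on_allocation y R"
    and "0 < v" and "r v \<le> v"
  shows "(\<forall>z\<ge>0. R (h v, r v) (h z, r z)) \<longleftrightarrow> truthful_at (\<lambda>z. y (h z)) r v"
proof -
  have more: "strictly_prefers R (a, q) (a', q')" if "y a > y a'" "q \<le> v" for a a' q q'
    using svm that \<open>0 < v\<close> by (auto simp: simple_value_maximizer_def)
  have cheaper: "strictly_prefers R (a, q) (a', q')" if "y a = y a'" "q < q'" "q \<le> v" for a a' q q'
    using svm that by (auto simp: simple_value_maximizer_def)
  have unaffordable: "R (a, q) (a', q')" if "v < q'" for a a' q q'
    using svm that by (auto simp: simple_value_maximizer_def)
  have same: "R (a, q) (a', q)" if "y a = y a'" for a a' q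
    using alloc that by (auto simp: depends_only_on_allocation_def)
  have "R (h v, r v) (h z, r z) \<longleftrightarrow>
      (r z \<le> v \<longrightarrow> y (h z) \<le> y (h v) \<and> (y (h z) = y (h v) \<longrightarrow> r v \<le> r z))" for z
  proof (cases "r z \<le> v")
    case False
    then show ?thesis using unaffordable by simp
  next
    case True
    consider "y (h z) < y (h v)" | "y (h z) > y (h v)"
      | "y (h z) = y (h v)" "r z < r v" | "y (h z) = y (h v)" "r v < r z"
      | "y (h z) = y (h v)" "r v = r z"
      by linarith
    then show ?thesis
    proof cases
      case 1
      then show ?thesis using more[of "h z" "h v"] \<open>r v \<le> v\<close> by (auto simp: strictly_prefers_def)
    next
      case 2
      then show ?thesis using more[of "h v" "h z"] True by (auto simp: strictly_prefers_def)
    next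
      case 3
      then show ?thesis using cheaper[of "h z" "h v"] True by (auto simp: strictly_prefers_def)
    next
      case 4
      then show ?thesis
        using cheaper[of "h v" "h z"] \<open>r v \<le> v\<close> by (auto simp: strictly_prefers_def)
    next
      case 5
      then show ?thesis using same[of "h v" "h z"] by simp
    qed
  qed
  then show ?thesis by (auto simp: truthful_at_def)
qed

text \<open>A nonempty open interval has positive measure, so \<open>P\<close> cannot fail on all of
  it.\<close>

lemma AE_lborel_obtain_between:
  fixes a b :: real
  assumes "AE v in lborel. P v" and "a < b"
  obtains w where "a < w" "w < b" "P w"
proof -
  have "\<not> (AE v in lborel. v \<notin> {a<..<b})"
    using \<open>a < b\<close> by (subst AE_iff_measurable[where N = "{a<..<b}"]) auto
  moreover have "AE v in lborel. v \<notin> {a<..<b}" if "\<forall>w\<in>{a<..<b}. \<not> P w"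
    using assms(1) by eventually_elim (use that in blast)
  ultimately show thesis using that by force
qed

lemma AE_lborel_positive:
  assumes "AE v in lborel. 0 < v \<longrightarrow> P (v::real)"
  shows "AE v in lborel. 0 \<le> v \<longrightarrow> P v"
  using assms AE_lborel_singleton[of 0] by eventually_elim auto

lemma countable_unattained_level_infima:
  fixes g :: "real \<Rightarrow> real"
  assumes mono: "\<And>v z. v \<in> V \<Longrightarrow> 0 \<le> z \<Longrightarrow> g v < g z \<Longrightarrow> v < z"
  shows "countable {v \<in> V. 0 \<le> v \<and> (\<exists>c>g v. (\<exists>w\<ge>0. c \<le> g w) \<and> v = Inf {w. 0 \<le> w \<and> c \<le> g w})}"
    (is "countable ?E")
proof -
  \<comment> \<open>The countability comes from choosing a rational \<open>q v\<close> strictly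
    inside the jump from \<open>g v\<close> up to the level \<open>c\<close>; these rationals
    increase strictly with \<open>v\<close>.\<close>
  let ?jump = "\<lambda>v q. \<exists>c. g v < q \<and> q < c \<and>
    (\<exists>w\<ge>0. c \<le> g w) \<and> v = Inf {w. 0 \<le> w \<and> c \<le> g w}"
  have "\<forall>v\<in>?E. \<exists>q. q \<in> \<rat> \<and> ?jump v q"
    using Rats_dense_in_real by fast
  then obtain q where q: "\<forall>v\<in>?E. q v \<in> \<rat> \<and> ?jump v (q v)"
    by (rule bchoice[THEN exE])
  have less: "q v < q v'" if "v \<in> ?E" "v' \<in> ?E" "v < v'" for v v'
  proof -
    obtain c where c: "q v < c" "\<exists>w\<ge>0. c \<le> g w" "v = Inf {w. 0 \<le> w \<and> c \<le> g w}"
      using bspec[OF q \<open>v \<in> ?E\<close>] by blast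
    have "\<exists>w\<in>{w. 0 \<le> w \<and> c \<le> g w}. w < v'"
      using c \<open>v < v'\<close> by (intro cInf_lessD) auto
    then obtain w where w: "0 \<le> w" "c \<le> g w" "w < v'" by auto
    \<comment> \<open>Contrapositive of \<open>mono\<close> at \<open>v'\<close>: the report
      \<open>w\<close> lies below \<open>v'\<close> but already reaches the level \<open>c\<close>
      above \<open>q v\<close>.\<close>
    have "g w \<le> g v'"
      using mono[of v' w] w \<open>v' \<in> ?E\<close> by fastforce
    moreover have "g v' < q v'" using bspec[OF q \<open>v' \<in> ?E\<close>] by blast
    ultimately show ?thesis using c w by linarith
  qed
  have "inj_on q ?E"
  proof (rule linorder_inj_onI)
    fix v v' assume "v < v'" "v \<in> ?E" "v' \<in> ?E"
    then show "q v \<noteq> q v'" using less[of v v'] by (intro less_imp_neq)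
  qed auto
  moreover have "countable (q ` ?E)"
    by (rule countable_subset[OF _ countable_rat]) (use q in blast)
  ultimately show ?thesis by (rule countable_image_inj_on[rotated])
qed

context
  fixes g r :: "real \<Rightarrow> real"
  assumes price_bounds: "\<And>z. 0 \<le> z \<Longrightarrow> 0 \<le> r z \<and> r z \<le> z"
begin

text \<open>A report \<open>z \<le> v\<close> costs at most \<open>z\<close>, hence is affordable at
  \<open>v\<close> and cannot be allocated more.\<close>

lemma truthful_at_greater_imp_greater:
  assumes "truthful_at g r v" and "0 \<le> z" and "g v < g z"
  shows "v < z"
  using assms price_bounds[of z] unfolding truthful_at_def by fastforce

lemma AE_truthful_imp_monotone:
  assumes "AE v in lborel. 0 \<le> v \<longrightarrow> truthful_at g r v"
  shows "AE v in lborel. 0 \<le> v \<longrightarrow>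
    (\<forall>z\<ge>0. g z > g v \<longrightarrow> z > v) \<and> (AE z in lborel. z > v \<longrightarrow> g z \<ge> g v)"
  using assms
proof eventually_elim
  case (elim v)
  \<comment> \<open>The roles are exchanged: \<open>z\<close> is now the truthful value and
    \<open>v\<close> the deviation, affordable because \<open>r v \<le> v < z\<close>.\<close>
  have "AE z in lborel. z > v \<longrightarrow> g z \<ge> g v" if "0 \<le> v"
    using assms
    by eventually_elim (use that price_bounds[of v] in \<open>auto simp: truthful_at_def\<close>)
  then show ?case using elim truthful_at_greater_imp_greater by blast
qed

lemma AE_truthful_imp_price_ge_Inf:
  assumes "AE v in lborel. 0 \<le> v \<longrightarrow> truthful_at g r v" and "0 \<le> v"
  shows "Inf {z. 0 \<le> z \<and> g z \<ge> g v} \<le> r v"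
proof (rule ccontr)
  assume "\<not> ?thesis"
  then have "r v < Inf {z. 0 \<le> z \<and> g z \<ge> g v}" by simp
  then obtain w where w: "r v < w" "w < Inf {z. 0 \<le> z \<and> g z \<ge> g v}" "0 \<le> w \<longrightarrow> truthful_at g r w"
    by (rule AE_lborel_obtain_between[OF assms(1)])
  have "0 \<le> w" using w price_bounds[OF \<open>0 \<le> v\<close>] by linarith
  \<comment> \<open>At the truthful value \<open>w\<close> the report \<open>v\<close> is
    affordable, so \<open>w\<close> belongs to the upper level set although it lies below its
    infimum. Truthfulness at \<open>v\<close> itself does not enter, which gives the bound for every
    \<open>v\<close>.\<close>
  then have "g v \<le> g w" using w \<open>0 \<le> v\<close> by (auto simp: truthful_at_def)
  then have "Inf {z. 0 \<le> z \<and> g z \<ge> g v} \<le> w"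
    using \<open>0 \<le> w\<close> by (intro cInf_lower bdd_belowI[of _ 0]) auto
  then show False using w by linarith
qed

text \<open>The reports allocated strictly more all exceed \<open>v\<close>, which is itself on the
  level, so adding them does not lower the infimum.\<close>

lemma Inf_upper_level_eq_Inf_level:
  fixes v :: real
  assumes "0 \<le> v" and "\<And>z. 0 \<le> z \<Longrightarrow> g v < g z \<Longrightarrow> v < z"
  shows "Inf {z. 0 \<le> z \<and> g z \<ge> g v} = Inf {z. 0 \<le> z \<and> g z = g v}"
proof (rule antisym)
  show "Inf {z. 0 \<le> z \<and> g z \<ge> g v} \<le> Inf {z. 0 \<le> z \<and> g z = g v}"
    using \<open>0 \<le> v\<close> by (intro cInf_superset_mono bdd_belowI[of _ 0]) auto
  have lower: "Inf {z. 0 \<le> z \<and> g z = g v} \<le> z" if "0 \<le> z" "g z = g v" for z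
    using that by (intro cInf_lower bdd_belowI[of _ 0]) auto
  show "Inf {z. 0 \<le> z \<and> g z = g v} \<le> Inf {z. 0 \<le> z \<and> g z \<ge> g v}"
  proof (rule cInf_greatest)
    fix z assume "z \<in> {z. 0 \<le> z \<and> g z \<ge> g v}"
    then show "Inf {z. 0 \<le> z \<and> g z = g v} \<le> z"
      using lower[of z] lower[of v] assms(2)[of z] \<open>0 \<le> v\<close> by fastforce
  qed (use \<open>0 \<le> v\<close> in auto)
qed

lemma AE_truthful_imp_price_eq_Inf:
  assumes "AE v in lborel. 0 \<le> v \<longrightarrow> truthful_at g r v"
  shows "AE v in lborel. 0 \<le> v \<longrightarrow> r v = Inf {z. 0 \<le> z \<and> g z = g v}"
  using assms
proof eventually_elim
  case (elim v)
  show ?case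
  proof
    assume "0 \<le> v"
    with elim have v: "truthful_at g r v" by blast
    have "r v \<le> Inf {z. 0 \<le> z \<and> g z = g v}"
    proof (rule cInf_greatest)
      fix z assume z: "z \<in> {z. 0 \<le> z \<and> g z = g v}"
      \<comment> \<open>If \<open>r z \<le> v\<close>, truthfulness gives
        \<open>r v \<le> r z \<le> z\<close>; otherwise
        \<open>r v \<le> v < r z \<le> z\<close>.\<close>
      then show "r v \<le> z"
        using v price_bounds[of z] price_bounds[OF \<open>0 \<le> v\<close>]
        unfolding truthful_at_def by (smt (verit) mem_Collect_eq)
    qed (use \<open>0 \<le> v\<close> in auto)
    moreover have "Inf {z. 0 \<le> z \<and> g z = g v} \<le> r v"
      using AE_truthful_imp_price_ge_Inf[OF assms \<open>0 \<le> v\<close>]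
        Inf_upper_level_eq_Inf_level[OF \<open>0 \<le> v\<close> truthful_at_greater_imp_greater[OF v]]
      by simp
    ultimately show "r v = Inf {z. 0 \<le> z \<and> g z = g v}" by (rule antisym)
  qed
qed

lemma monotone_pricing_imp_AE_truthful:
  assumes mono: "AE v in lborel. 0 \<le> v \<longrightarrow> (\<forall>z\<ge>0. g z > g v \<longrightarrow> z > v)"
    and price_eq: "AE v in lborel. 0 \<le> v \<longrightarrow> r v = Inf {z. 0 \<le> z \<and> g z = g v}"
    and price_ge: "\<And>v. 0 \<le> v \<Longrightarrow> Inf {z. 0 \<le> z \<and> g z \<ge> g v} \<le> r v"
  shows "AE v in lborel. 0 \<le> v \<longrightarrow> truthful_at g r v"
proof -
  \<comment> \<open>Restricting to the values where monotonicity holds makes the hypothesis of the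
    countability lemma hold without exceptions.\<close>
  define V where "V = {v. 0 \<le> v \<and> (\<forall>z\<ge>0. g z > g v \<longrightarrow> z > v)}"
  let ?E = "{v \<in> V. 0 \<le> v \<and> (\<exists>c>g v. (\<exists>w\<ge>0. c \<le> g w) \<and> v = Inf {w. 0 \<le> w \<and> c \<le> g w})}"
  have "countable ?E"
    by (rule countable_unattained_level_infima) (simp add: V_def)
  then have "AE v in lborel. v \<notin> ?E"
    by (intro AE_not_in countable_imp_null_set_lborel)
  with mono price_eq show ?thesis
  proof eventually_elim
    case (elim v)
    show ?case
      unfolding truthful_at_def
    proof (intro impI allI conjI)
      fix z :: real assume "0 \<le> v" "0 \<le> z" "r z \<le> v"
      have v: "v < w" if "0 \<le> w" "g v < g w" for w
        using elim \<open>0 \<le> v\<close> that by blast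
      show "g z \<le> g v"
      proof (rule ccontr)
        assume "\<not> g z \<le> g v"
        \<comment> \<open>Every report reaching the level \<open>g z\<close> exceeds
          \<open>v\<close>, while the price bound at \<open>z\<close> puts the infimum of such
          reports at or below \<open>r z \<le> v\<close>. So \<open>v\<close> lies in the
          exceptional set, with \<open>c = g z\<close>.\<close>
        then have "v \<le> Inf {w. 0 \<le> w \<and> g z \<le> g w}"
          using \<open>0 \<le> z\<close> v by (intro cInf_greatest) (auto simp: less_imp_le less_le_trans)
        moreover have "Inf {w. 0 \<le> w \<and> g z \<le> g w} \<le> v"
          using price_ge[OF \<open>0 \<le> z\<close>] \<open>r z \<le> v\<close> by linarith
        ultimately have "v = Inf {w. 0 \<le> w \<and> g z \<le> g w}" by (rule antisym)
        moreover have "v \<in> V" using \<open>0 \<le> v\<close> v by (simp add: V_def)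
        ultimately have "v \<in> ?E" using \<open>\<not> g z \<le> g v\<close> \<open>0 \<le> v\<close> \<open>0 \<le> z\<close> by force
        then show False using elim by blast
      qed
      assume "g z = g v"
      \<comment> \<open>As \<open>g z = g v\<close>, the lower bound on \<open>r z\<close> is the
        infimum of the upper level set of \<open>v\<close>, which equals \<open>r v\<close>.\<close>
      then show "r v \<le> r z"
        using price_ge[OF \<open>0 \<le> z\<close>] Inf_upper_level_eq_Inf_level[OF \<open>0 \<le> v\<close> v] elim \<open>0 \<le> v\<close>
        by simp
    qed
  qed
qed

lemma AE_truthful_iff:
  "(AE v in lborel. 0 \<le> v \<longrightarrow> truthful_at g r v) \<longleftrightarrow>
    (AE v in lborel. 0 \<le> v \<longrightarrow>
      (\<forall>z\<ge>0. g z > g v \<longrightarrow> z > v) \<and> (AE z in lborel. z > v \<longrightarrow> g z \<ge> g v)) \<and>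
    (AE v in lborel. 0 \<le> v \<longrightarrow> r v = Inf {z. 0 \<le> z \<and> g z = g v}) \<and>
    (\<forall>v\<ge>0. r v \<ge> Inf {z. 0 \<le> z \<and> g z \<ge> g v})"
  (is "?truthful \<longleftrightarrow> ?mono \<and> ?eq \<and> ?ge")
proof (intro iffI)
  assume ?truthful
  then show "?mono \<and> ?eq \<and> ?ge"
    using AE_truthful_imp_monotone AE_truthful_imp_price_eq_Inf AE_truthful_imp_price_ge_Inf
    by blast
next
  assume *: "?mono \<and> ?eq \<and> ?ge"
  then have "AE v in lborel. 0 \<le> v \<longrightarrow> (\<forall>z\<ge>0. g z > g v \<longrightarrow> z > v)"
    by (auto elim: eventually_mono)
  with * show ?truthful by (intro monotone_pricing_imp_AE_truthful) auto
qed

end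

theorem theorem3:
  fixes x :: "'n::finite \<Rightarrow> 'o \<Rightarrow> real"
    and pref :: "'n \<Rightarrow> real \<Rightarrow> 'o \<times> real \<Rightarrow> 'o \<times> real \<Rightarrow> bool"
    and f :: "('n \<Rightarrow> real) \<Rightarrow> 'o"
    and p :: "'n \<Rightarrow> ('n \<Rightarrow> real) \<Rightarrow> real"
  assumes likelihood: "\<And>i a. 0 \<le> x i a \<and> x i a \<le> 1"
    and value_maximizer: "\<And>i v. 0 \<le> v \<Longrightarrow> simple_value_maximizer (x i) v (pref i v)"
    and single_parameter: "\<And>i v. 0 \<le> v \<Longrightarrow> depends_only_on_allocation (x i) (pref i v)"
    and price_bounds: "\<And>i b. b \<in> profiles \<Longrightarrow> 0 \<le> p i b \<and> p i b \<le> b i"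
  shows "dsic_ae pref f p \<longleftrightarrow> (\<forall>i. monotone_ae x f i \<and> minimum_pricing x f p i)"
proof -
  have bounds: "0 \<le> p i (b(i := z)) \<and> p i (b(i := z)) \<le> z" if "b \<in> profiles" "0 \<le> z" for i b z
    using price_bounds[of "b(i := z)" i] that by (simp add: profiles_def)
  have "(AE v in lborel. 0 \<le> v \<longrightarrow>
        (\<forall>z\<ge>0. pref i v (f (b(i := v)), p i (b(i := v))) (f (b(i := z)), p i (b(i := z))))) \<longleftrightarrow>
      (AE v in lborel. 0 \<le> v \<longrightarrow> truthful_at (alloc_curve x f i b) (\<lambda>z. p i (b(i := z))) v)"
    (is "?prefers \<longleftrightarrow> ?truthful") if "b \<in> profiles" for i b
  proof -
    have iff: "(\<forall>z\<ge>0. pref i v (f (b(i := v)), p i (b(i := v))) (f (b(i := z)), p i (b(i := z)))) \<longleftrightarrow>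
        truthful_at (alloc_curve x f i b) (\<lambda>z. p i (b(i := z))) v" if "0 < v" for v
      using truthful_at_iff_prefers[where r = "\<lambda>z. p i (b(i := z))" and h = "\<lambda>z. f (b(i := z))",
          OF value_maximizer single_parameter, of v i]
        bounds[OF \<open>b \<in> profiles\<close>, of v i] that
      by (simp add: alloc_curve_def[abs_def])
    show ?thesis
    proof
      assume ?prefers
      then show ?truthful
        by (intro AE_lborel_positive) (auto elim!: eventually_mono simp: iff)
    next
      assume ?truthful
      then show ?prefers
        by (intro AE_lborel_positive) (auto elim!: eventually_mono simp: iff)
    qed
  qed
  then have "dsic_ae pref f p \<longleftrightarrow> (\<forall>i. \<forall>b\<in>profiles. AE v in lborel. 0 \<le> v \<longrightarrow>
      truthful_at (alloc_curve x f i b) (\<lambda>z. p i (b(i := z))) v)"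
    by (simp add: dsic_ae_def)
  also have "\<dots> \<longleftrightarrow> (\<forall>i. monotone_ae x f i \<and> minimum_pricing x f p i)"
  proof -
    have "(\<forall>b\<in>profiles. AE v in lborel. 0 \<le> v \<longrightarrow>
        truthful_at (alloc_curve x f i b) (\<lambda>z. p i (b(i := z))) v) \<longleftrightarrow>
      monotone_ae x f i \<and> minimum_pricing x f p i" for i
      \<comment> \<open>Merging the quantifiers over \<open>b\<close> reduces the claim to the
        one-dimensional equivalence for each fixed \<open>b\<close>.\<close>
      unfolding monotone_ae_def minimum_pricing_def ball_conj_distrib[symmetric]
      by (intro ball_cong refl AE_truthful_iff bounds)
    then show ?thesis by simp
  qed
  finally show ?thesis .
qed

end
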